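(* Let $C\subset\mathbb{R}^d$ be a convex body that is lattice reduced with respect to a $d$-dimensional lattice $\Lambda$, and let $k$ be the dimension of the linear span of the set of width directions $y\in\Lambda^\star$ of $C$. Then $C$ is a polytope with at most $2^{k+1}-2$ vertices.
   Context: A convex body is a compact convex set with non-empty interior. A lattice $\Lambda\subset\mathbb{R}^d$ is a discrete subgroup spanning $\mathbb{R}^d$; $\Lambda^\star=\{y: x\cdot y\in\mathbb{Z}\ \forall x\in\Lambda\}$. The lattice width is $\mathrm{wdt}_\Lambda(C)=\min_{y\in\Lambda^\star\setminus\{0\}}\max_{a,b\in C}y\cdot(a-b)$; a width direction is a $y\in\Lambda^\star\setminus\{0\}$ attaining this minimum. $C$ is lattice reduced if no convex body $C'\subsetneq C$ has $\mathrm{wdt}_\Lambda(C')=\mathrm{wdt}_\Lambda(C)$. *)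

theory Defs
  imports "HOL-Analysis.Analysis"
begin

definition convex_body :: "'a::euclidean_space set \<Rightarrow> bool" where
  "convex_body C \<longleftrightarrow> compact C \<and> convex C \<and> interior C \<noteq> {}"

definition is_lattice :: "'a::euclidean_space set \<Rightarrow> bool" where
  "is_lattice L \<longleftrightarrow> 0 \<in> L \<and> (\<forall>x\<in>L. \<forall>y\<in>L. x - y \<in> L) \<and> discrete L \<and> span L = UNIV"

definition dual_lattice :: "'a::euclidean_space set \<Rightarrow> 'a set" where
  "dual_lattice L = {y. \<forall>x\<in>L. x \<bullet> y \<in> \<int>}"

definition width_in_dir :: "'a::euclidean_space set \<Rightarrow> 'a \<Rightarrow> real" where
  "width_in_dir C y = Sup {y \<bullet> (a - b) | a b. a \<in> C \<and> b \<in> C}"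

definition lattice_width :: "'a::euclidean_space set \<Rightarrow> 'a set \<Rightarrow> real" where
  "lattice_width L C = Inf (width_in_dir C ` (dual_lattice L - {0}))"

definition width_direction :: "'a::euclidean_space set \<Rightarrow> 'a set \<Rightarrow> 'a \<Rightarrow> bool" where
  "width_direction L C y \<longleftrightarrow> y \<in> dual_lattice L - {0} \<and> width_in_dir C y = lattice_width L C"

definition lattice_reduced :: "'a::euclidean_space set \<Rightarrow> 'a set \<Rightarrow> bool" where
  "lattice_reduced L C \<longleftrightarrow> convex_body C \<and>
     (\<forall>C'. convex_body C' \<and> C' \<subset> C \<longrightarrow> lattice_width L C' \<noteq> lattice_width L C)"

end

theory Submission
  imports Defs
begin

text \<open>Every extreme point \<open>v\<close> of a reduced body \<open>C\<close> is the unique maximiser over \<open>C\<close> of some width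
  direction: otherwise a small neighbourhood of \<open>v\<close> could be cut off without decreasing the width,
  because only finitely many dual vectors compete for the minimum. Choose such a \<open>y\<^sub>v\<close> for every
  \<open>v\<close> and reduce it modulo \<open>2M\<close>, where \<open>M\<close> consists of the dual vectors in the span of the width
  directions; \<open>M/2M\<close> has at most \<open>2\<^sup>k\<close> classes. The zero class does not occur, as half of a width
  direction would have smaller width. If \<open>y\<^sub>u\<close> and \<open>y\<^sub>v\<close> are congruent and \<open>y\<^sub>u + y\<^sub>v \<noteq> 0\<close>, then their
  midpoint is a nonzero dual vector, so by minimality some point maximises both \<open>y\<^sub>u\<close> and \<open>y\<^sub>v\<close>, and
  \<open>u = v\<close>. Hence at most two extreme points share a class.\<close>

section \<open>Widths of compact sets and convex bodies\<close>

lemma width_in_dir_attained: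
  assumes "compact C" "C \<noteq> {}"
  obtains a b where "a \<in> C" "b \<in> C" "width_in_dir C y = y \<bullet> (a - b)"
    "\<And>x. x \<in> C \<Longrightarrow> y \<bullet> x \<le> y \<bullet> a" "\<And>x. x \<in> C \<Longrightarrow> y \<bullet> b \<le> y \<bullet> x"
proof -
  have cont: "continuous_on C (\<lambda>x. y \<bullet> x)"
    by (intro continuous_intros)
  obtain a where a: "a \<in> C" "\<And>x. x \<in> C \<Longrightarrow> y \<bullet> x \<le> y \<bullet> a"
    using continuous_attains_sup[OF assms cont] by blast
  obtain b where b: "b \<in> C" "\<And>x. x \<in> C \<Longrightarrow> y \<bullet> b \<le> y \<bullet> x"
    using continuous_attains_inf[OF assms cont] by blast
  have "width_in_dir C y = y \<bullet> (a - b)"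
    unfolding width_in_dir_def
  proof (rule cSup_eq_maximum)
    show "y \<bullet> (a - b) \<in> {y \<bullet> (a - b) |a b. a \<in> C \<and> b \<in> C}"
      using a b by blast
    show "x \<le> y \<bullet> (a - b)" if "x \<in> {y \<bullet> (a - b) |a b. a \<in> C \<and> b \<in> C}" for x
      using that a(2) b(2) by (force simp: inner_diff_right intro: diff_mono)
  qed
  then show thesis
    using that a b by blast
qed

lemma width_in_dir_ge:
  assumes "compact C" "a \<in> C" "b \<in> C"
  shows "y \<bullet> (a - b) \<le> width_in_dir C y"
proof -
  have "C \<noteq> {}" using assms by blast
  then obtain a' b' where "width_in_dir C y = y \<bullet> (a' - b')" "y \<bullet> a \<le> y \<bullet> a'" "y \<bullet> b' \<le> y \<bullet> b"
    using width_in_dir_attained[OF assms(1)] assms by metis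
  then show ?thesis
    by (simp add: inner_diff_right)
qed

lemma width_in_dir_nonneg:
  assumes "compact C" "C \<noteq> {}"
  shows "0 \<le> width_in_dir C y"
  using assms width_in_dir_ge[OF assms(1)] by fastforce

lemma width_in_dir_mono:
  assumes "compact C'" "compact C" "C' \<noteq> {}" "C' \<subseteq> C"
  shows "width_in_dir C' y \<le> width_in_dir C y"
  by (metis assms subsetD width_in_dir_attained width_in_dir_ge)

lemma width_in_dir_uminus: "width_in_dir C (- y) = width_in_dir C y"
proof -
  have "{- y \<bullet> (a - b) |a b. a \<in> C \<and> b \<in> C} = {y \<bullet> (a - b) |a b. a \<in> C \<and> b \<in> C}"
    by (force simp: inner_diff_right)
  then show ?thesis
    unfolding width_in_dir_def by simp
qed

lemma convex_body_compact: "convex_body C \<Longrightarrow> compact C"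
  and convex_body_convex: "convex_body C \<Longrightarrow> convex C"
  and convex_body_nonempty: "convex_body C \<Longrightarrow> C \<noteq> {}"
  by (auto simp: convex_body_def)

text \<open>A ball inside \<open>C\<close> already has width proportional to \<open>norm y\<close>.
  This makes widths in nonzero directions positive and confines directions of bounded width to a
  bounded set.\<close>

lemma width_in_dir_ge_norm:
  assumes "convex_body C"
  obtains r where "r > 0" "\<And>y. r * norm y \<le> width_in_dir C y"
proof -
  obtain p where "p \<in> interior C"
    using assms by (auto simp: convex_body_def)
  then obtain r where r: "r > 0" "cball p r \<subseteq> C"
    by (meson mem_interior_cball)
  have "r * norm y \<le> width_in_dir C y" for y
  proof -
    have "p + r *\<^sub>R sgn y \<in> cball p r" "p \<in> cball p r"
      using r by (auto simp: dist_norm norm_sgn)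
    then have "p + r *\<^sub>R sgn y \<in> C" "p \<in> C"
      using r by auto
    then have "y \<bullet> (p + r *\<^sub>R sgn y - p) \<le> width_in_dir C y"
      using width_in_dir_ge assms convex_body_compact by blast
    moreover have "y \<bullet> sgn y = norm y"
      by (cases "y = 0") (simp_all add: sgn_div_norm dot_square_norm power2_eq_square)
    ultimately show ?thesis
      by simp
  qed
  with r that show thesis by blast
qed

section \<open>The dual lattice and the lattice width\<close>

lemma dual_lattice_diff: "x \<in> dual_lattice L \<Longrightarrow> y \<in> dual_lattice L \<Longrightarrow> x - y \<in> dual_lattice L"
  by (auto simp: dual_lattice_def inner_diff_right)

lemma dual_lattice_uminus: "x \<in> dual_lattice L \<Longrightarrow> - x \<in> dual_lattice L"
  by (auto simp: dual_lattice_def)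

lemma zero_in_dual_lattice: "0 \<in> dual_lattice L"
  by (auto simp: dual_lattice_def)

lemma orthogonal_span_UNIV:
  fixes y :: "'a::euclidean_space"
  assumes "span B = UNIV" "\<And>b. b \<in> B \<Longrightarrow> b \<bullet> y = 0"
  shows "y = 0"
proof -
  have "orthogonal y y"
    by (rule orthogonal_to_span[of _ B])
      (use assms in \<open>auto simp: orthogonal_def inner_commute\<close>)
  then show ?thesis
    by (simp add: orthogonal_def)
qed

text \<open>A dual vector is determined by its inner products with a basis contained in
  \<open>L\<close>; these are integers, and Cauchy-Schwarz bounds them.\<close>

lemma finite_dual_lattice_bounded:
  fixes L :: "'a::euclidean_space set"
  assumes "span L = UNIV"
  shows "finite {y \<in> dual_lattice L. norm y \<le> K}" (is "finite ?A")
proof -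
  obtain B where B: "B \<subseteq> L" "independent B" "L \<subseteq> span B"
    using maximal_independent_subset by metis
  have "finite B"
    using B(2) independent_bound by blast
  have "span B = UNIV"
    using assms span_mono[OF B(3)] by (auto simp: span_span)
  define f where "f y = restrict (\<lambda>b. b \<bullet> y) B" for y
  have "f ` ?A \<subseteq> PiE B (\<lambda>b. {x \<in> \<int>. - (norm b * K) \<le> x \<and> x \<le> norm b * K})"
  proof (rule image_subsetI)
    fix y assume y: "y \<in> ?A"
    have "\<bar>b \<bullet> y\<bar> \<le> norm b * K" for b
      by (rule order_trans[OF Cauchy_Schwarz_ineq2]) (use y in \<open>simp add: mult_left_mono\<close>)
    moreover have "b \<bullet> y \<in> \<int>" if "b \<in> B" for b
      using y B(1) that by (auto simp: dual_lattice_def)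
    ultimately show "f y \<in> PiE B (\<lambda>b. {x \<in> \<int>. - (norm b * K) \<le> x \<and> x \<le> norm b * K})"
      by (auto simp: f_def abs_le_iff minus_le_iff)
  qed
  moreover have "finite (PiE B (\<lambda>b. {x \<in> \<int>. - (norm b * K) \<le> x \<and> x \<le> norm b * K}))"
    using \<open>finite B\<close> by (intro finite_PiE finite_int_segment)
  ultimately have "finite (f ` ?A)"
    by (rule finite_subset)
  moreover have "inj f"
  proof (rule injI)
    fix x y assume "f x = f y"
    then have "b \<bullet> (x - y) = 0" if "b \<in> B" for b
      using that unfolding f_def restrict_def fun_eq_iff by (metis inner_diff_right right_minus_eq)
    then have "x - y = 0"
      by (rule orthogonal_span_UNIV[OF \<open>span B = UNIV\<close>])
    then show "x = y" by simp
  qed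
  ultimately show ?thesis
    by (meson finite_imageD inj_on_subset subset_UNIV)
qed

lemma lattice_width_le:
  assumes "convex_body C" "y \<in> dual_lattice L" "y \<noteq> 0"
  shows "lattice_width L C \<le> width_in_dir C y"
  unfolding lattice_width_def
proof (rule cInf_lower)
  show "width_in_dir C y \<in> width_in_dir C ` (dual_lattice L - {0})"
    using assms by blast
  show "bdd_below (width_in_dir C ` (dual_lattice L - {0}))"
    using width_in_dir_nonneg[OF convex_body_compact convex_body_nonempty] assms
    by (intro bdd_belowI[of _ 0]) auto
qed

text \<open>A nonzero dual vector keeps the infimum from ranging over the empty set, where
  \<open>Inf\<close> on the reals carries no information.\<close>

lemma lattice_width_nonneg:
  assumes "convex_body C" "dual_lattice L \<noteq> {0}"
  shows "0 \<le> lattice_width L C"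
  unfolding lattice_width_def
  using assms zero_in_dual_lattice[of L]
    width_in_dir_nonneg[OF convex_body_compact convex_body_nonempty]
  by (intro cInf_greatest) auto

section \<open>Cutting off a neighbourhood of an extreme point\<close>

lemma convex_body_hull_diff_ball:
  assumes "convex_body C" "x \<in> interior C" "e < dist v x"
  shows "convex_body (convex hull (C - ball v e))"
proof -
  have "x \<in> interior (C - ball v e)"
  proof (rule interiorI)
    show "open (interior C - cball v e)"
      by (simp add: open_Diff)
    show "x \<in> interior C - cball v e"
      using assms by auto
    show "interior C - cball v e \<subseteq> C - ball v e"
      using interior_subset[of C] ball_subset_cball[of v e] by blast
  qed
  then have "interior (convex hull (C - ball v e)) \<noteq> {}"
    using interior_mono[OF hull_subset[of "C - ball v e" convex]] by blast
  moreover have "compact (C - ball v e)"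
    using assms by (simp add: convex_body_compact compact_diff)
  ultimately show ?thesis
    by (simp add: convex_body_def compact_convex_hull)
qed

text \<open>If \<open>v\<close> lay in the smaller hull it would be extreme there too, hence one of
  the generating points, yet the ball removes it.\<close>

lemma hull_diff_ball_psubset:
  assumes "convex_body C" "v extreme_point_of C" "e > 0"
  shows "convex hull (C - ball v e) \<subset> C"
proof -
  have sub: "convex hull (C - ball v e) \<subseteq> C"
    using assms by (intro hull_minimal) (auto simp: convex_body_convex)
  have "v \<notin> convex hull (C - ball v e)"
  proof
    assume "v \<in> convex hull (C - ball v e)"
    then have "v extreme_point_of (convex hull (C - ball v e))"
      using assms(2) sub unfolding extreme_point_of_def by blast
    then have "v \<in> C - ball v e"
      by (rule extreme_point_of_convex_hull)
    then show False
      using assms(3) by simp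
  qed
  moreover have "v \<in> C"
    using assms(2) by (simp add: extreme_point_of_def)
  ultimately show ?thesis
    using sub by blast
qed

text \<open>Otherwise every nonzero dual vector has a pair of points other than \<open>v\<close>
  that are at least the lattice width apart. One small ball about \<open>v\<close> then misses the
  pairs of the finitely many critical vectors, and removing it leaves a smaller body of the same
  lattice width.\<close>

lemma dual_vector_drops_at_extreme_point:
  assumes L: "is_lattice L" and red: "lattice_reduced L C" and v: "v extreme_point_of C"
  obtains y where "y \<in> dual_lattice L" "y \<noteq> 0"
    "\<And>a b. a \<in> C - {v} \<Longrightarrow> b \<in> C - {v} \<Longrightarrow> y \<bullet> (a - b) < lattice_width L C"
proof (rule ccontr)
  assume "\<not> thesis"
  with that have contra: "\<exists>a\<in>C - {v}. \<exists>b\<in>C - {v}. lattice_width L C \<le> y \<bullet> (a - b)"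
    if "y \<in> dual_lattice L" "y \<noteq> 0" for y
    using that by (meson not_less)
  define w where "w = lattice_width L C"
  define K where "K e = convex hull (C - ball v e)" for e
  have C: "convex_body C"
    using red by (simp add: lattice_reduced_def)
  have "interior C \<noteq> {v}"
    using not_open_singleton open_interior by metis
  then obtain x where x: "x \<in> interior C" "x \<noteq> v"
    using C unfolding convex_body_def by blast
  define e0 where "e0 = dist v x / 2"
  have e0: "e0 > 0" "\<And>e. e \<le> e0 \<Longrightarrow> e < dist v x"
  proof -
    have "dist v x > 0"
      using x by simp
    then show "e0 > 0" "\<And>e. e \<le> e0 \<Longrightarrow> e < dist v x"
      unfolding e0_def by linarith+
  qed
  have K_body: "convex_body (K e)" if "e \<le> e0" for e
    using convex_body_hull_diff_ball[OF C x(1) e0(2)] that by (simp add: K_def)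
  have K_psub: "K e \<subset> C" if "e > 0" for e
    using hull_diff_ball_psubset[OF C v] that by (simp add: K_def)
  have K_anti: "K e' \<subseteq> K e" if "e \<le> e'" for e e'
    unfolding K_def using that by (intro hull_mono) auto
  have neq: "lattice_width L (K e) \<noteq> w" if "e > 0" "e \<le> e0" for e
    using red K_body K_psub that unfolding lattice_reduced_def w_def by blast
  \<comment> \<open>Without nonzero dual vectors all lattice widths would be the same value
    \<open>Inf {}\<close>, against \<open>neq\<close>.\<close>
  have dual: "dual_lattice L - {0} \<noteq> {}"
  proof
    assume "dual_lattice L - {0} = {}"
    then have "lattice_width L (K e0) = w"
      by (simp only: lattice_width_def w_def image_empty)
    then show False
      using neq e0 by simp
  qed
  obtain r where r: "r > 0" "\<And>y. r * norm y \<le> width_in_dir (K e0) y"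
    using width_in_dir_ge_norm[OF K_body] by blast
  \<comment> \<open>Vectors outside \<open>F\<close> have width at least \<open>w\<close> on
    \<open>K e0\<close>, hence on every \<open>K e\<close> with \<open>e \<le> e0\<close>; only
    those in \<open>F\<close> constrain the radius further.\<close>
  define F where "F = {y \<in> dual_lattice L - {0}. width_in_dir (K e0) y < w}"
  have "finite F"
  proof (rule finite_subset)
    have "norm y \<le> w / r" if "y \<in> F" for y
      using r(1) r(2)[of y] that by (simp add: F_def pos_le_divide_eq mult.commute)
    then show "F \<subseteq> {y \<in> dual_lattice L. norm y \<le> w / r}"
      by (auto simp: F_def)
    show "finite {y \<in> dual_lattice L. norm y \<le> w / r}"
      using L by (simp add: is_lattice_def finite_dual_lattice_bounded)
  qed
  have "\<exists>d>0. \<forall>e\<le>min d e0. w \<le> width_in_dir (K e) y" if "y \<in> F" for y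
  proof -
    have "y \<in> dual_lattice L" "y \<noteq> 0"
      using that by (auto simp: F_def)
    then obtain a b where ab: "a \<in> C - {v}" "b \<in> C - {v}" "w \<le> y \<bullet> (a - b)"
      using contra unfolding w_def by blast
    \<comment> \<open>The removed ball is open, so a radius up to the distances from
      \<open>v\<close> to \<open>a\<close> and \<open>b\<close> keeps both points.\<close>
    have "w \<le> width_in_dir (K e) y" if "e \<le> min (min (dist v a) (dist v b)) e0" for e
    proof -
      have "a \<in> K e" "b \<in> K e"
        using that ab unfolding K_def by (auto intro!: hull_inc)
      then show ?thesis
        using width_in_dir_ge[OF convex_body_compact[OF K_body], of e a b y] that ab by simp
    qed
    moreover have "min (dist v a) (dist v b) > 0"
      using ab by auto
    ultimately show ?thesis
      by blast
  qed
  then obtain d where d: "\<And>y. y \<in> F \<Longrightarrow> d y > 0"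
    "\<And>y e. y \<in> F \<Longrightarrow> e \<le> min (d y) e0 \<Longrightarrow> w \<le> width_in_dir (K e) y"
    by metis
  \<comment> \<open>Inserting \<open>e0\<close> keeps \<open>Min\<close> meaningful for empty
    \<open>F\<close> and ensures \<open>e \<le> e0\<close>.\<close>
  define e where "e = Min (insert e0 (d ` F))"
  have e: "e > 0" "e \<le> e0" "\<And>y. y \<in> F \<Longrightarrow> e \<le> d y"
    unfolding e_def using \<open>finite F\<close> d(1) e0 by auto
  have "w \<le> width_in_dir (K e) y" if "y \<in> dual_lattice L - {0}" for y
  proof (cases "y \<in> F")
    case True
    then show ?thesis
      using d(2) e by simp
  next
    case False
    then have "w \<le> width_in_dir (K e0) y"
      using that by (simp add: F_def)
    also have "\<dots> \<le> width_in_dir (K e) y"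
      using K_body e K_anti
      by (intro width_in_dir_mono) (auto simp: convex_body_compact dest: convex_body_nonempty)
    finally show ?thesis .
  qed
  then have "w \<le> lattice_width L (K e)"
    unfolding lattice_width_def using dual by (intro cInf_greatest) auto
  moreover have "lattice_width L (K e) \<le> w"
  proof -
    have "lattice_width L (K e) \<le> width_in_dir C y" if "y \<in> dual_lattice L - {0}" for y
    proof -
      have "lattice_width L (K e) \<le> width_in_dir (K e) y"
        using lattice_width_le[OF K_body] e that by blast
      also have "\<dots> \<le> width_in_dir C y"
        using K_body[OF e(2)] C K_psub[OF e(1)]
        by (intro width_in_dir_mono) (auto simp: convex_body_compact dest: convex_body_nonempty)
      finally show ?thesis .
    qed
    then show ?thesis
      unfolding w_def lattice_width_def[of L C] using dual by (intro cInf_greatest) auto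
  qed
  ultimately show False
    using neq[OF e(1,2)] by simp
qed

text \<open>If the gap from \<open>v\<close> to \<open>b\<close> exceeded \<open>w\<close>, moving
  from \<open>v\<close> towards \<open>b\<close> would reach a point other than \<open>v\<close>
  whose gap to \<open>b\<close> is exactly \<open>w\<close>, contradicting the drop.\<close>

lemma width_in_dir_eq_of_drop:
  assumes "convex C" "v \<in> C" "b \<in> C" "b \<noteq> v" "0 \<le> w"
    and W: "w \<le> y \<bullet> (v - b)"
    and drop: "\<And>a b. a \<in> C - {v} \<Longrightarrow> b \<in> C - {v} \<Longrightarrow> y \<bullet> (a - b) < w"
  shows "y \<bullet> (v - b) = w"
proof (rule ccontr)
  define W where "W = y \<bullet> (v - b)"
  define t where "t = 1 - w / W"
  define x where "x = (1 - t) *\<^sub>R v + t *\<^sub>R b"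
  assume "y \<bullet> (v - b) \<noteq> w"
  with W have "w < W"
    by (simp add: W_def)
  then have t: "0 < t" "t \<le> 1" "(1 - t) * W = w"
    using \<open>0 \<le> w\<close> by (auto simp: t_def)
  have "x \<in> C"
    unfolding x_def using assms t by (intro convexD) auto
  moreover have "x - v = t *\<^sub>R (b - v)" "x - b = (1 - t) *\<^sub>R (v - b)"
    by (simp_all add: x_def algebra_simps)
  moreover from this have "x \<noteq> v" "y \<bullet> (x - b) = w"
    using t \<open>b \<noteq> v\<close> by (auto simp: W_def)
  ultimately show False
    using drop[of x b] assms(3,4) by simp
qed

text \<open>A pair attaining the width in the dropping direction must contain \<open>v\<close>, and
  a sign change makes \<open>v\<close> the maximiser. The width then equals the lattice width, and a
  second maximiser would give a pair avoiding \<open>v\<close> with too large a gap.\<close>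

lemma extreme_point_unique_maximiser:
  assumes L: "is_lattice L" and red: "lattice_reduced L C" and v: "v extreme_point_of C"
  shows "\<exists>y. width_direction L C y \<and> (\<forall>x\<in>C. x \<noteq> v \<longrightarrow> y \<bullet> x < y \<bullet> v)"
proof -
  define w where "w = lattice_width L C"
  have C: "convex_body C"
    using red by (simp add: lattice_reduced_def)
  obtain y where y: "y \<in> dual_lattice L" "y \<noteq> 0"
    and drop: "\<And>a b. a \<in> C - {v} \<Longrightarrow> b \<in> C - {v} \<Longrightarrow> y \<bullet> (a - b) < w"
    using dual_vector_drops_at_extreme_point[OF assms] unfolding w_def by blast
  have w: "0 \<le> w" "w \<le> width_in_dir C y"
    using y C lattice_width_nonneg[OF C] lattice_width_le[OF C] unfolding w_def by auto
  have "width_in_dir C y > 0"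
    by (metis C width_in_dir_ge_norm y(2) less_le_trans mult_pos_pos zero_less_norm_iff)
  \<comment> \<open>Stated for arbitrary \<open>z\<close> so that it serves both \<open>y\<close>
    and \<open>- y\<close>.\<close>
  have key: ?thesis
    if z: "z \<in> dual_lattice L" "z \<noteq> 0" "width_in_dir C z = z \<bullet> (v - b)" "w \<le> z \<bullet> (v - b)"
      and b: "b \<in> C" "b \<noteq> v"
      and drop: "\<And>a b. a \<in> C - {v} \<Longrightarrow> b \<in> C - {v} \<Longrightarrow> z \<bullet> (a - b) < w" for z b
  proof (intro exI conjI ballI impI)
    have "v \<in> C"
      using v by (simp add: extreme_point_of_def)
    then have "z \<bullet> (v - b) = w"
      using width_in_dir_eq_of_drop[OF convex_body_convex[OF C] _ b w(1) z(4) drop] by blast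
    then show "width_direction L C z"
      using z by (simp add: width_direction_def w_def)
    show "z \<bullet> x < z \<bullet> v" if "x \<in> C" "x \<noteq> v" for x
      using drop[of x b] z(4) that b by (simp add: inner_diff_right)
  qed
  obtain a b where ab: "a \<in> C" "b \<in> C" "width_in_dir C y = y \<bullet> (a - b)"
    using width_in_dir_attained[OF convex_body_compact convex_body_nonempty] C by metis
  have "a \<noteq> b"
    using ab(3) \<open>width_in_dir C y > 0\<close> by auto
  moreover have "a = v \<or> b = v"
    using drop[of a b] ab w(2) by force
  ultimately consider "a = v" "b \<noteq> v" | "b = v" "a \<noteq> v"
    by blast
  then show ?thesis
  proof cases
    case 1
    then show ?thesis
      using key[of y b] y ab w drop by simp
  next
    case 2
    have eq: "- y \<bullet> (v - a) = y \<bullet> (a - b)"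
      using 2 by (simp add: inner_diff_right)
    show ?thesis
    proof (rule key[of "- y" a])
      show "- y \<bullet> (p - q) < w" if "p \<in> C - {v}" "q \<in> C - {v}" for p q
        using drop[OF that(2,1)] by (simp add: inner_diff_right)
    qed (use eq y ab w 2 in \<open>simp_all add: dual_lattice_uminus width_in_dir_uminus\<close>)
  qed
qed

section \<open>Dual vectors modulo 2\<close>

text \<open>The integer-valued functionals \<open>y \<mapsto> b \<bullet> y\<close> with \<open>b \<in> L\<close> split off one cyclic factor at a time,
  so no lattice basis is needed.\<close>

lemma dual_subgroup_mod_2_representatives:
  fixes L M :: "'a::euclidean_space set"
  assumes "span L = UNIV" "M \<subseteq> dual_lattice L" "0 \<in> M" "\<And>x y. x \<in> M \<Longrightarrow> y \<in> M \<Longrightarrow> x - y \<in> M"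
  shows "\<exists>R. finite R \<and> card R \<le> 2 ^ dim M \<and> (\<forall>y\<in>M. \<exists>r\<in>R. \<exists>z\<in>M. y = r + 2 *\<^sub>R z)"
  using assms(2-4)
proof (induction "dim M" arbitrary: M rule: less_induct)
  case less
  note sub = less.prems(3)
  have neg: "- x \<in> M" if "x \<in> M" for x
    using sub[OF less.prems(2) that] by simp
  have add: "x + y \<in> M" if "x \<in> M" "y \<in> M" for x y
    using sub[OF that(1) neg[OF that(2)]] by simp
  have nat_mult: "real n *\<^sub>R x \<in> M" if "x \<in> M" for n x
    by (induction n) (use that add less.prems in \<open>auto simp: scaleR_add_left\<close>)
  have int_mult: "real_of_int n *\<^sub>R x \<in> M" if "x \<in> M" for n x
    using nat_mult[OF that, of "nat \<bar>n\<bar>"] neg[OF nat_mult[OF that, of "nat \<bar>n\<bar>"]]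
    by (cases "n \<ge> 0") auto
  show ?case
  proof (cases "M = {0}")
    case True
    then show ?thesis
      by (intro exI[of _ "{0}"]) auto
  next
    case False
    then obtain y where y: "y \<in> M" "y \<noteq> 0"
      using less.prems by blast
    then obtain b where b: "b \<in> L" "b \<bullet> y \<noteq> 0"
      using orthogonal_span_UNIV[OF assms(1)] by blast
    \<comment> \<open>The floor only changes the type: \<open>b \<bullet> x\<close> is an integer
      for \<open>x\<close> in \<open>M\<close>.\<close>
    define \<phi> where "\<phi> x = \<lfloor>b \<bullet> x\<rfloor>" for x
    have \<phi>: "real_of_int (\<phi> x) = b \<bullet> x" if "x \<in> M" for x
    proof -
      have "b \<bullet> x \<in> \<int>"
        using that b less.prems(1) by (auto simp: dual_lattice_def)
      then show ?thesis
        by (auto simp: \<phi>_def elim: Ints_cases)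
    qed
    have "y \<in> M \<and> \<phi> y \<noteq> 0"
      using \<phi> y b by force
    \<comment> \<open>An element of least nonzero absolute value under \<open>\<phi>\<close>, so
      that \<open>\<phi> m\<close> divides every value of \<open>\<phi>\<close> on
      \<open>M\<close>.\<close>
    then obtain m where m: "m \<in> M" "\<phi> m \<noteq> 0"
      and min: "\<And>x. x \<in> M \<Longrightarrow> \<phi> x \<noteq> 0 \<Longrightarrow> nat \<bar>\<phi> m\<bar> \<le> nat \<bar>\<phi> x\<bar>"
      using ex_has_least_nat[of "\<lambda>x. x \<in> M \<and> \<phi> x \<noteq> 0" y "\<lambda>x. nat \<bar>\<phi> x\<bar>"] by blast
    define M' where "M' = {x \<in> M. b \<bullet> x = 0}"
    have "M' \<subseteq> {x. b \<bullet> x = 0}" "subspace {x. b \<bullet> x = 0}"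
      by (auto simp: M'_def subspace_hyperplane)
    then have "span M' \<subseteq> {x. b \<bullet> x = 0}"
      by (rule span_minimal)
    moreover have "m \<in> span M"
      using m by (simp add: span_base)
    moreover have "b \<bullet> m \<noteq> 0"
      using \<phi> m by force
    ultimately have "span M' \<subset> span M"
      using span_mono[of M' M] by (auto simp: M'_def)
    then have dim: "dim M' < dim M"
      by (rule dim_psubset)
    have "\<exists>R. finite R \<and> card R \<le> 2 ^ dim M' \<and> (\<forall>y\<in>M'. \<exists>r\<in>R. \<exists>z\<in>M'. y = r + 2 *\<^sub>R z)"
      using less.prems
      by (intro less.hyps[OF dim]) (auto simp: M'_def inner_diff_right)
    then obtain R where R: "finite R" "card R \<le> 2 ^ dim M'"
      "\<And>y. y \<in> M' \<Longrightarrow> \<exists>r\<in>R. \<exists>z\<in>M'. y = r + 2 *\<^sub>R z"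
      by blast
    \<comment> \<open>Representatives of the kernel \<open>M'\<close>, with and without
      \<open>m\<close> added, cover \<open>M\<close>: the count doubles while the dimension drops by
      at least one.\<close>
    have "card (R \<union> (+) m ` R) \<le> 2 * card R"
      using card_Un_le[of R "(+) m ` R"] card_image_le[OF R(1), of "(+) m"] by linarith
    also have "\<dots> \<le> 2 ^ Suc (dim M')"
      using R(2) by simp
    also have "\<dots> \<le> 2 ^ dim M"
      using dim by (intro power_increasing) auto
    finally have "card (R \<union> (+) m ` R) \<le> 2 ^ dim M" .
    moreover have "\<exists>r\<in>R \<union> (+) m ` R. \<exists>z\<in>M. x = r + 2 *\<^sub>R z" if x: "x \<in> M" for x
    proof -
      \<comment> \<open>Division with remainder: minimality of \<open>m\<close> forces remainder 0,
        which puts \<open>x'\<close> into the kernel. The parity of \<open>q\<close> then decides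
        between \<open>r\<close> and \<open>m + r\<close>.\<close>
      define q where "q = \<phi> x div \<phi> m"
      define x' where "x' = x - real_of_int q *\<^sub>R m"
      have x': "x' \<in> M"
        unfolding x'_def using x m int_mult sub by blast
      have "real_of_int (\<phi> x') = real_of_int (\<phi> x - q * \<phi> m)"
        using \<phi>[OF x'] \<phi>[OF x] \<phi>[OF m(1)] by (simp add: x'_def inner_diff_right)
      then have "\<phi> x' = \<phi> x mod \<phi> m"
        unfolding q_def by (metis minus_div_mult_eq_mod of_int_eq_iff)
      then have "\<bar>\<phi> x'\<bar> < \<bar>\<phi> m\<bar>"
        using m(2) by (simp add: abs_mod_less)
      then have "\<phi> x' = 0"
        using min[OF x'] by force
      then have "x' \<in> M'"
        using \<phi>[OF x'] x' by (simp add: M'_def)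
      then obtain r z where rz: "r \<in> R" "z \<in> M" "x' = r + 2 *\<^sub>R z"
        using R(3) unfolding M'_def by blast
      define k where "k = q div 2"
      have z': "z + real_of_int k *\<^sub>R m \<in> M"
        using rz int_mult m add by blast
      consider "q = 2 * k" | "q = 2 * k + 1"
        unfolding k_def by linarith
      then show ?thesis
      proof cases
        case 1
        then have "x = r + 2 *\<^sub>R (z + real_of_int k *\<^sub>R m)"
          using rz(3) by (simp add: x'_def algebra_simps)
        with rz z' show ?thesis by blast
      next
        case 2
        then have "x = (m + r) + 2 *\<^sub>R (z + real_of_int k *\<^sub>R m)"
          using rz(3) by (simp add: x'_def algebra_simps)
        with rz z' show ?thesis by blast
      qed
    qed
    ultimately show ?thesis
      using R(1) by (intro exI[of _ "R \<union> (+) m ` R"]) auto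
  qed
qed

section \<open>Width directions in one class modulo 2\<close>

text \<open>Congruence modulo 2 is expressed through the sum, whose half is the dual vector to test.
  A nonzero \<open>z\<close> would have width below the average of the widths of \<open>y\<close>
  and \<open>y'\<close>, both minimal.\<close>

lemma congruent_unique_maximisers:
  assumes C: "convex_body C"
    and y: "width_direction L C y" "width_direction L C y'"
    and u: "u \<in> C" "\<forall>x\<in>C. x \<noteq> u \<longrightarrow> y \<bullet> x < y \<bullet> u"
    and v: "v \<in> C" "\<forall>x\<in>C. x \<noteq> v \<longrightarrow> y' \<bullet> x < y' \<bullet> v"
    and z: "z \<in> dual_lattice L" "y + y' = 2 *\<^sub>R z"
    and "u \<noteq> v"
  shows "y' = - y"
proof (rule ccontr)
  assume "y' \<noteq> - y"
  then have "z \<noteq> 0"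
    using z(2) by (metis add.commute add_eq_0_iff scaleR_zero_right)
  then have w: "lattice_width L C \<le> width_in_dir C z"
    using lattice_width_le[OF C] z by blast
  obtain a b where ab: "a \<in> C" "b \<in> C" "width_in_dir C z = z \<bullet> (a - b)"
    using width_in_dir_attained[OF convex_body_compact convex_body_nonempty] C by metis
  have "y \<bullet> (u - b) \<le> lattice_width L C" "y' \<bullet> (v - b) \<le> lattice_width L C"
    using width_in_dir_ge[OF convex_body_compact[OF C] u(1) ab(2), of y]
      width_in_dir_ge[OF convex_body_compact[OF C] v(1) ab(2), of y'] y
    by (simp_all add: width_direction_def)
  moreover have "y \<bullet> (a - b) + y' \<bullet> (a - b) = 2 * (z \<bullet> (a - b))"
    using z(2) by (metis inner_add_left inner_scaleR_left)
  \<comment> \<open>As \<open>u \<noteq> v\<close>, the point \<open>a\<close> differs from one of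
    them, where the inequality is strict.\<close>
  moreover have "y \<bullet> a < y \<bullet> u \<or> y' \<bullet> a < y' \<bullet> v" "y \<bullet> a \<le> y \<bullet> u" "y' \<bullet> a \<le> y' \<bullet> v"
    using u v ab \<open>u \<noteq> v\<close> by (metis order.strict_iff_not order_refl nle_le)+
  ultimately show False
    using w ab(3) by (auto simp: inner_diff_right)
qed

text \<open>Such a \<open>z\<close> would have half the width of \<open>y\<close>; since widths in
  nonzero directions are positive, this lies below the minimum.\<close>

lemma width_direction_not_double:
  assumes C: "convex_body C" and y: "width_direction L C y" and z: "z \<in> dual_lattice L"
  shows "y \<noteq> 2 *\<^sub>R z"
proof
  assume yz: "y = 2 *\<^sub>R z"
  with y have "z \<noteq> 0"
    by (auto simp: width_direction_def)
  then have w: "lattice_width L C \<le> width_in_dir C z"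
    using lattice_width_le[OF C] z by blast
  obtain a b where ab: "a \<in> C" "b \<in> C" "width_in_dir C z = z \<bullet> (a - b)"
    using width_in_dir_attained[OF convex_body_compact convex_body_nonempty] C by metis
  have "width_in_dir C z > 0"
    by (metis C width_in_dir_ge_norm \<open>z \<noteq> 0\<close> less_le_trans mult_pos_pos zero_less_norm_iff)
  moreover have "2 * (z \<bullet> (a - b)) \<le> lattice_width L C"
    using width_in_dir_ge[OF convex_body_compact[OF C] ab(1,2), of y] y yz
    by (simp add: width_direction_def)
  ultimately show False
    using w ab(3) by simp
qed

text \<open>Finiteness is part of the conclusion because \<open>card\<close> is 0 on infinite
  sets.\<close>

lemma card_le_2I:
  assumes "\<And>x y z. x \<in> A \<Longrightarrow> y \<in> A \<Longrightarrow> z \<in> A \<Longrightarrow> x \<noteq> y \<Longrightarrow> x \<noteq> z \<Longrightarrow> y = z"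
  shows "finite A \<and> card A \<le> 2"
proof -
  obtain x y where "A \<subseteq> {x, y}"
    using assms by (cases "A = {}") (blast, metis insertCI subsetI)
  then show ?thesis
    using card_mono[of "{x, y}" A] card_insert_le_m1[of 2 "{y}" x] finite_subset by fastforce
qed

section \<open>Counting the extreme points\<close>

theorem theorem3p2:
  fixes L C :: "'a::euclidean_space set"
  assumes "is_lattice L" and "convex_body C" and "lattice_reduced L C"
  shows "polytope C \<and>
    card {v. v extreme_point_of C} \<le> 2 ^ (dim {y. width_direction L C y} + 1) - 2"
proof -
  define V where "V = {v. v extreme_point_of C}"
  define Y where "Y = {y. width_direction L C y}"
  \<comment> \<open>Intersecting with the span of the width directions makes their dimension, not
    that of the whole space, govern the number of classes.\<close>
  define M where "M = dual_lattice L \<inter> span Y"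
  have V_C: "V \<subseteq> C"
    by (auto simp: V_def extreme_point_of_def)
  obtain f where f: "\<And>v. v \<in> V \<Longrightarrow> width_direction L C (f v)"
    "\<And>v. v \<in> V \<Longrightarrow> \<forall>x\<in>C. x \<noteq> v \<longrightarrow> f v \<bullet> x < f v \<bullet> v"
    using extreme_point_unique_maximiser[OF assms(1,3)] unfolding V_def mem_Collect_eq by metis
  have "Y \<subseteq> M"
    by (auto simp: M_def Y_def width_direction_def span_base)
  have "dim M \<le> dim Y"
    by (metis M_def Int_lower2 dim_span dim_subset)
  have diff: "x - y \<in> M" if "x \<in> M" "y \<in> M" for x y
    using that by (auto simp: M_def dual_lattice_diff span_diff)
  have "0 \<in> M"
    by (simp add: M_def zero_in_dual_lattice span_zero)
  have "span L = UNIV" "M \<subseteq> dual_lattice L"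
    using assms(1) by (auto simp: is_lattice_def M_def)
  from dual_subgroup_mod_2_representatives[OF this \<open>0 \<in> M\<close> diff]
  obtain R where R: "finite R" "card R \<le> 2 ^ dim M"
    "\<And>y. y \<in> M \<Longrightarrow> \<exists>r\<in>R. \<exists>z\<in>M. y = r + 2 *\<^sub>R z"
    by blast
  \<comment> \<open>\<open>r0\<close> represents the zero class but need not be 0. It is itself
    twice an element of \<open>M\<close>, so everything it represents is a double.\<close>
  obtain r0 z0 where r0: "r0 \<in> R" "z0 \<in> M" "0 = r0 + 2 *\<^sub>R z0"
    using R(3)[OF \<open>0 \<in> M\<close>] by blast
  define A where "A r = {v \<in> V. \<exists>z\<in>M. f v = r + 2 *\<^sub>R z}" for r
  have fM: "f v \<in> M" if "v \<in> V" for v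
    using f(1)[OF that] \<open>Y \<subseteq> M\<close> by (auto simp: Y_def)
  have V_A: "V \<subseteq> (\<Union>r\<in>R - {r0}. A r)"
  proof
    fix v assume v: "v \<in> V"
    then obtain r z where rz: "r \<in> R" "z \<in> M" "f v = r + 2 *\<^sub>R z"
      using R(3) fM by blast
    have "r \<noteq> r0"
    proof
      assume "r = r0"
      then have "f v = 2 *\<^sub>R (z - z0)"
        using rz(3) r0(3) by (simp add: algebra_simps eq_neg_iff_add_eq_0)
      moreover have "z - z0 \<in> dual_lattice L"
        using diff rz r0 by (simp add: M_def)
      ultimately show False
        using width_direction_not_double[OF assms(2) f(1)[OF v]] by blast
    qed
    then show "v \<in> (\<Union>r\<in>R - {r0}. A r)"
      using v rz by (auto simp: A_def)
  qed
  have opp: "f v = - f u" if uv: "u \<in> A r" "v \<in> A r" "u \<noteq> v" for u v r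
  proof -
    obtain z z' where z: "z \<in> M" "f u = r + 2 *\<^sub>R z" "z' \<in> M" "f v = r + 2 *\<^sub>R z'"
      using uv by (auto simp: A_def)
    have u: "u \<in> V" and v: "v \<in> V"
      using uv by (auto simp: A_def)
    \<comment> \<open>The sum is \<open>2 *\<^sub>R f u\<close> minus the difference
      \<open>f u - f v\<close>, which is twice \<open>z - z'\<close>.\<close>
    have "f u + f v = 2 *\<^sub>R (f u - (z - z'))"
      using z by (simp add: algebra_simps scaleR_2)
    moreover have "f u - (z - z') \<in> dual_lattice L"
      using diff z fM[OF u] by (simp add: M_def)
    ultimately show ?thesis
      using congruent_unique_maximisers[OF assms(2) f(1)[OF u] f(1)[OF v] _ f(2)[OF u] _ f(2)[OF v]]
        u v V_C \<open>u \<noteq> v\<close> by blast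
  qed
  have A2: "finite (A r) \<and> card (A r) \<le> 2" for r
  proof (rule card_le_2I)
    fix x y z assume xyz: "x \<in> A r" "y \<in> A r" "z \<in> A r" "x \<noteq> y" "x \<noteq> z"
    \<comment> \<open>Both equal \<open>- f x\<close>, and a functional has at most one unique
      maximiser.\<close>
    then have "f y = f z"
      using opp by metis
    moreover have "y \<in> V" "z \<in> V"
      using xyz by (auto simp: A_def)
    ultimately show "y = z"
      using f(2)[of y] f(2)[of z] V_C by (metis less_asym subsetD)
  qed
  have fin: "finite (\<Union>r\<in>R - {r0}. A r)"
    using R(1) A2 by blast
  then have "finite V"
    using V_A finite_subset by blast
  have "card V \<le> card (\<Union>r\<in>R - {r0}. A r)"
    using fin V_A by (rule card_mono)
  also have "\<dots> \<le> (\<Sum>r\<in>R - {r0}. card (A r))"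
    using R(1) by (intro card_UN_le) auto
  also have "\<dots> \<le> card (R - {r0}) * 2"
    using sum_bounded_above[of "R - {r0}" "\<lambda>r. card (A r)" 2] A2 by simp
  also have "\<dots> = (card R - 1) * 2"
    using r0(1) by simp
  also have "\<dots> \<le> (2 ^ dim Y - 1) * 2"
  proof -
    have "(2::nat) ^ dim M \<le> 2 ^ dim Y"
      using \<open>dim M \<le> dim Y\<close> by (intro power_increasing) auto
    then show ?thesis
      using R(2) by (intro mult_right_mono diff_le_mono) linarith+
  qed
  also have "\<dots> = 2 ^ (dim Y + 1) - 2"
    by (simp add: diff_mult_distrib)
  finally have "card V \<le> 2 ^ (dim Y + 1) - 2" .
  \<comment> \<open>By Krein-Milman the finite set \<open>V\<close> generates \<open>C\<close>; the
    cardinality bound alone would not give a polytope.\<close>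
  moreover have "C = convex hull V"
    unfolding V_def using assms(2)
    by (intro Krein_Milman_Minkowski) (auto simp: convex_body_def)
  then have "polytope C"
    using \<open>finite V\<close> unfolding polytope_def by blast
  ultimately show ?thesis
    by (simp add: V_def Y_def)
qed

end
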